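(* Let $X$ be a complex Banach space and let $\sigma(\cdot)$ be a joint spectrum for complex solvable finite dimensional Lie algebras of operators defined on $X$. Then there is a uniquely determined map, also denoted by $\sigma(\cdot)$, assigning to each complex quasi-solvable Lie subalgebra $\mathcal L$ of $\mathcal L(X)$ a set $\sigma(\mathcal L)$, such that for every complex quasi-solvable Lie subalgebra $\mathcal L$ of $\mathcal L(X)$ the following conditions are fulfilled: (i) $\sigma(\mathcal L)$ is a subset of the characters of $\mathcal L$ and (via $f\mapsto (f|_{I_\alpha})_{\alpha\in\mathbb I}$) a compact nonempty subset of $\prod_{\alpha\in\mathbb I}\sigma(I_\alpha)$, where $\mathbb I$ indexes the set of all complex solvable finite dimensional ideals $I_\alpha$ of $\mathcal L$, and $\sigma(I_\alpha)$ in the product is the given finite dimensional joint spectrum of $I_\alpha$; (ii) if $\mathcal H$ is a complex solvable finite dimensional ideal of $\mathcal L$, then $\sigma(\mathcal H)$ coincides with the originally given joint spectrum of $\mathcal H$ defined in the finite dimensional case; (iii) if $\mathcal M$ is a Lie subalgebra of $\mathcal L$ and $\mathcal H$ is a Lie ideal of $\mathcal M$, then the projection property for ideals holds, i.e. $\sigma(\mathcal M)|_{\mathcal H}=\sigma(\mathcal H)$.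
   Context: $\mathcal L(X)$ denotes the algebra of bounded linear operators on $X$, regarded as a Lie algebra with the commutator bracket; Lie algebras of operators on $X$ are Lie subalgebras of $\mathcal L(X)$. A character of a complex Lie algebra $L$ is a linear functional $f:L\to\mathbb C$ with $f([L,L])=0$. A joint spectrum (for complex solvable finite dimensional Lie algebras of operators on $X$) is a function $\sigma$ which assigns to each complex solvable finite dimensional Lie algebra $L$ of operators on $X$ a compact nonempty subset $\sigma(L)\subseteq L^*$ consisting of characters of $L$ ($L^*$ is the dual space with its usual topology), such that if $H$ is a Lie ideal of $L$ and $\pi:L^*\to H^*$ is the restriction map, then $\pi(\sigma(L))=\sigma(H)$ (projection property for ideals). A complex Lie algebra $\mathcal L$ is quasi-solvable if $\mathcal L=\sum_{\alpha\in I}I_\alpha$ (every element is a finite sum of elements of the $I_\alpha$), where $I$ is an index set and each $I_\alpha$ is a complex solvable finite dimensional ideal of $\mathcal L$. A Lie subalgebra $\mathcal M$ of a quasi-solvable $\mathcal L=\sum_{\alpha\in I} I_\alpha$ is again quasi-solvable, with $\mathcal M=\sum_{\alpha\in\mathbb I}\mathcal M\cap I_\alpha$, where $(I_\alpha)_{\alpha\in\mathbb I}$ is the family of all complex solvable finite dimensional ideals of $\mathcal L$; so $\sigma(\mathcal M)$ and $\sigma(\mathcal H)$ make sense in (iii). For a set $S$ of functionals on $\mathcal M$ and a subspace $\mathcal H\subseteq\mathcal M$, $S|_{\mathcal H}=\{f|_{\mathcal H}: f\in S\}$. The product $\prod_{\alpha\in\mathbb I}\sigma(I_\alpha)$ carries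 the product topology. *)

theory Defs
  imports "HOL-Analysis.Analysis"
begin

section \<open>Complex Banach spaces and their bounded complex-linear operators\<close>

class complex_banach = banach +
  fixes scaleC :: "complex \<Rightarrow> 'a \<Rightarrow> 'a" (infixr "*\<^sub>C" 75)
  assumes scaleC_add_right: "a *\<^sub>C (x + y) = a *\<^sub>C x + a *\<^sub>C y"
    and scaleC_add_left: "(a + b) *\<^sub>C x = a *\<^sub>C x + b *\<^sub>C x"
    and scaleC_scaleC: "a *\<^sub>C b *\<^sub>C x = (a * b) *\<^sub>C x"
    and scaleC_of_real: "of_real r *\<^sub>C x = r *\<^sub>R x"
    and norm_scaleC: "norm (a *\<^sub>C x) = cmod a * norm x"

lift_definition scaleC_blinfun ::
  "complex \<Rightarrow> ('a::real_normed_vector \<Rightarrow>\<^sub>L 'b::complex_banach) \<Rightarrow> 'a \<Rightarrow>\<^sub>L 'b"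
  is "\<lambda>c T x. c *\<^sub>C T x"
proof -
  fix c :: complex and T :: "'a \<Rightarrow> 'b"
  assume T: "bounded_linear T"
  have "bounded_linear (\<lambda>y::'b. c *\<^sub>C y)"
    by (rule bounded_linear_intro[where K = "cmod c"])
      (simp_all add: scaleC_add_right norm_scaleC scaleC_scaleC mult.commute
        flip: scaleC_of_real)
  then show "bounded_linear (\<lambda>x. c *\<^sub>C T x)"
    using T by (rule bounded_linear_compose)
qed

global_interpretation cop: vector_space
  "scaleC_blinfun :: complex \<Rightarrow> ('a::real_normed_vector \<Rightarrow>\<^sub>L 'b::complex_banach) \<Rightarrow> 'a \<Rightarrow>\<^sub>L 'b"
proof
  fix a b :: complex and S T :: "'a \<Rightarrow>\<^sub>L 'b"
  show "scaleC_blinfun a (S + T) = scaleC_blinfun a S + scaleC_blinfun a T"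
    by transfer (simp add: scaleC_add_right)
  show "scaleC_blinfun (a + b) T = scaleC_blinfun a T + scaleC_blinfun b T"
    by transfer (simp add: scaleC_add_left)
  show "scaleC_blinfun a (scaleC_blinfun b T) = scaleC_blinfun (a * b) T"
    by transfer (simp add: scaleC_scaleC)
  show "scaleC_blinfun 1 T = T"
    by transfer (use scaleC_of_real[of 1, where 'a = 'b] in simp)
qed

text \<open>The elements of \<^typ>\<open>'a \<Rightarrow>\<^sub>L 'a\<close> are only required to be real-linear.\<close>

definition clinear_operators :: "('a::complex_banach \<Rightarrow>\<^sub>L 'a) set" where
  "clinear_operators = {T. \<forall>c x. blinfun_apply T (c *\<^sub>C x) = c *\<^sub>C blinfun_apply T x}"

section \<open>Lie algebras of operators\<close>

definition lie_bracket ::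
  "('a::complex_banach \<Rightarrow>\<^sub>L 'a) \<Rightarrow> ('a \<Rightarrow>\<^sub>L 'a) \<Rightarrow> 'a \<Rightarrow>\<^sub>L 'a" where
  "lie_bracket S T = (S o\<^sub>L T) - (T o\<^sub>L S)"

definition lie_algebra :: "('a::complex_banach \<Rightarrow>\<^sub>L 'a) set \<Rightarrow> bool" where
  "lie_algebra L \<longleftrightarrow>
    L \<subseteq> clinear_operators \<and> cop.subspace L \<and> (\<forall>S\<in>L. \<forall>T\<in>L. lie_bracket S T \<in> L)"

definition lie_subalgebra ::
  "('a::complex_banach \<Rightarrow>\<^sub>L 'a) set \<Rightarrow> ('a \<Rightarrow>\<^sub>L 'a) set \<Rightarrow> bool" where
  "lie_subalgebra M L \<longleftrightarrow> lie_algebra M \<and> M \<subseteq> L"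

definition lie_ideal ::
  "('a::complex_banach \<Rightarrow>\<^sub>L 'a) set \<Rightarrow> ('a \<Rightarrow>\<^sub>L 'a) set \<Rightarrow> bool" where
  "lie_ideal H L \<longleftrightarrow>
    cop.subspace H \<and> H \<subseteq> L \<and> (\<forall>S\<in>L. \<forall>T\<in>H. lie_bracket S T \<in> H)"

definition lie_derived :: "('a::complex_banach \<Rightarrow>\<^sub>L 'a) set \<Rightarrow> ('a \<Rightarrow>\<^sub>L 'a) set" where
  "lie_derived L = cop.span {lie_bracket S T | S T. S \<in> L \<and> T \<in> L}"

definition lie_solvable :: "('a::complex_banach \<Rightarrow>\<^sub>L 'a) set \<Rightarrow> bool" where
  "lie_solvable L \<longleftrightarrow> (\<exists>n. (lie_derived ^^ n) L = {0})"

definition fin_dim :: "('a::complex_banach \<Rightarrow>\<^sub>L 'a) set \<Rightarrow> bool" where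
  "fin_dim L \<longleftrightarrow> (\<exists>B. finite B \<and> cop.span B = L)"

definition fs_ideals :: "('a::complex_banach \<Rightarrow>\<^sub>L 'a) set \<Rightarrow> ('a \<Rightarrow>\<^sub>L 'a) set set" where
  "fs_ideals L = {I. lie_ideal I L \<and> lie_solvable I \<and> fin_dim I}"

definition quasi_solvable :: "('a::complex_banach \<Rightarrow>\<^sub>L 'a) set \<Rightarrow> bool" where
  "quasi_solvable L \<longleftrightarrow>
    lie_algebra L \<and>
    (\<exists>F \<subseteq> fs_ideals L.
      L = {\<Sum>I\<in>G. v I | G v. finite G \<and> G \<subseteq> F \<and> (\<forall>I\<in>G. v I \<in> I)})"

section \<open>Functionals, characters and joint spectra\<close>

text \<open>
  A functional on \<open>L\<close> is encoded as a function on the whole operator type that is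
  \<^const>\<open>undefined\<close> outside \<open>L\<close>, so that equality of functionals on \<open>L\<close> is equality of
  functions and \<open>restrict f H\<close> is the restriction of the functional \<open>f\<close> to a subspace \<open>H\<close>.
\<close>

definition lie_dual ::
  "('a::complex_banach \<Rightarrow>\<^sub>L 'a) set \<Rightarrow> (('a \<Rightarrow>\<^sub>L 'a) \<Rightarrow> complex) set" where
  "lie_dual L = {f \<in> extensional L.
    (\<forall>S\<in>L. \<forall>T\<in>L. f (S + T) = f S + f T) \<and>
    (\<forall>c. \<forall>T\<in>L. f (scaleC_blinfun c T) = c * f T)}"

definition characters ::
  "('a::complex_banach \<Rightarrow>\<^sub>L 'a) set \<Rightarrow> (('a \<Rightarrow>\<^sub>L 'a) \<Rightarrow> complex) set" where
  "characters L = {f \<in> lie_dual L. \<forall>T\<in>lie_derived L. f T = 0}"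

text \<open>
  Only used for finite dimensional \<open>L\<close>. There the dual space is finite dimensional and
  carries a single Hausdorff vector space topology, which is the topology of pointwise
  convergence on \<open>L\<close>.
\<close>

definition dual_topology ::
  "('a::complex_banach \<Rightarrow>\<^sub>L 'a) set \<Rightarrow> (('a \<Rightarrow>\<^sub>L 'a) \<Rightarrow> complex) topology" where
  "dual_topology L = subtopology (product_topology (\<lambda>_. euclidean) L) (lie_dual L)"

text \<open>The values of \<open>\<sigma>\<close> outside the finite dimensional solvable Lie algebras are irrelevant.\<close>

definition joint_spectrum ::
  "(('a::complex_banach \<Rightarrow>\<^sub>L 'a) set \<Rightarrow> (('a \<Rightarrow>\<^sub>L 'a) \<Rightarrow> complex) set) \<Rightarrow> bool" where
  "joint_spectrum \<sigma> \<longleftrightarrow>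
    (\<forall>L. lie_algebra L \<and> lie_solvable L \<and> fin_dim L \<longrightarrow>
      \<sigma> L \<subseteq> characters L \<and> \<sigma> L \<noteq> {} \<and> compactin (dual_topology L) (\<sigma> L) \<and>
      (\<forall>H. lie_ideal H L \<longrightarrow> (\<lambda>f. restrict f H) ` \<sigma> L = \<sigma> H))"

end

theory Submission
  imports Defs
begin

text \<open>
  Projection onto ideals leaves no choice: every \<open>f \<in> \<tau> L\<close> restricts into \<open>\<sigma> I\<close> for each
  finite dimensional solvable ideal \<open>I\<close> of \<open>L\<close>. So \<open>\<tau> L\<close> lies in the inverse limit of the
  \<open>\<sigma> I\<close>, the set \<open>limit_spectrum \<sigma> L\<close> of all functionals on \<open>L\<close> with this property, and
  the claim is that the whole inverse limit is the answer. Two facts carry the proof.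

  The first is that sums of two finite dimensional solvable ideals are again such ideals, so that
  these ideals form a directed family; \<open>L\<close> is quasi-solvable exactly when they cover it
  (\<open>quasi_solvable_iff\<close>). Hence any finite set of operators, and any finite dimensional
  subspace, lies in a single member of the family. Functionals can thus be glued from
  coherent families on the ideals, and linearity and vanishing on commutators are checked inside
  one ideal.

  The second is compactness. By Tychonoff's theorem \<open>\<Prod>\<^sub>I \<sigma> I\<close> is compact, and a point of the
  inverse limit with prescribed values is a point of a directed intersection of closed subsets,
  one for each ideal \<open>J\<close>, expressing the requirements that can be seen within \<open>J\<close>. Each of
  these subsets is nonempty because \<open>\<sigma> J \<rightarrow> \<sigma> K\<close> is onto for an ideal \<open>K\<close> of \<open>J\<close>. This
  extends a given element of the inverse limit over an ideal \<open>H\<close> of \<open>M\<close> to one over \<open>M\<close>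
  (\<open>limit_spectrum_extend\<close>), where the relevant ideals of \<open>J\<close> are the \<open>H \<inter> J\<close>. Nonemptiness is
  the case \<open>H = {0}\<close>. Conversely a functional over \<open>M\<close> restricts correctly to \<open>H\<close>: a finite
  dimensional solvable ideal \<open>K\<close> of \<open>H\<close> need not be an ideal of \<open>M\<close>, but it is an ideal of
  \<open>H \<inter> I\<close> for an ideal \<open>I\<close> of \<open>M\<close> that contains it, and \<open>H \<inter> I\<close> is an ideal of \<open>M\<close>.

  Uniqueness is density together with compactness: a competitor \<open>\<tau> L\<close> has the same restrictions to every
  single ideal as the inverse limit, so by directedness it is dense in it, and being compact in a
  Hausdorff space it is closed (\<open>compact_eq_limit_spectrum\<close>).
\<close>

section \<open>Sums of finite dimensional solvable ideals\<close>

lemma lie_bracket_add_left: "lie_bracket (S + S') T = lie_bracket S T + lie_bracket S' T"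
  by (simp add: lie_bracket_def bounded_bilinear.add_left[OF bounded_bilinear_blinfun_compose]
      bounded_bilinear.add_right[OF bounded_bilinear_blinfun_compose])

lemma lie_bracket_add_right: "lie_bracket S (T + T') = lie_bracket S T + lie_bracket S T'"
  by (simp add: lie_bracket_def bounded_bilinear.add_left[OF bounded_bilinear_blinfun_compose]
      bounded_bilinear.add_right[OF bounded_bilinear_blinfun_compose])

lemma lie_bracket_swap: "lie_bracket S T = - lie_bracket T S"
  by (simp add: lie_bracket_def)

lemma lie_bracket_zero_right: "lie_bracket S 0 = 0"
  by (simp add: lie_bracket_def)

lemma lie_bracket_ideal:
  assumes "lie_ideal I L" "S \<in> L" "T \<in> I"
  shows "lie_bracket S T \<in> I" "lie_bracket T S \<in> I"
proof -
  show *: "lie_bracket S T \<in> I" using assms by (auto simp: lie_ideal_def)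
  then show "lie_bracket T S \<in> I"
    using assms(1) lie_bracket_swap[of T S] by (simp add: lie_ideal_def cop.subspace_neg)
qed

lemma lie_ideal_imp_lie_algebra:
  assumes "lie_algebra L" "lie_ideal I L"
  shows "lie_algebra I"
  using assms by (auto simp: lie_algebra_def lie_ideal_def)

lemma lie_derived_mono: "K \<subseteq> L \<Longrightarrow> lie_derived K \<subseteq> lie_derived L"
  unfolding lie_derived_def by (rule cop.span_mono) auto

lemma lie_derived_funpow_mono: "K \<subseteq> L \<Longrightarrow> (lie_derived ^^ n) K \<subseteq> (lie_derived ^^ n) L"
  by (induction n) (auto dest: lie_derived_mono)

lemma lie_derived_subset: "lie_algebra L \<Longrightarrow> lie_derived L \<subseteq> L"
  unfolding lie_derived_def by (rule cop.span_minimal) (auto simp: lie_algebra_def)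

lemma lie_derived_funpow_subset:
  assumes "lie_algebra L"
  shows "(lie_derived ^^ n) L \<subseteq> L"
proof (induction n)
  case (Suc n)
  then show ?case
    using lie_derived_mono[OF Suc] lie_derived_subset[OF assms] by auto
qed simp

lemma subspace_lie_derived_funpow:
  assumes "cop.subspace L"
  shows "cop.subspace ((lie_derived ^^ n) L)"
  using assms by (cases n) (simp_all add: lie_derived_def)

lemma lie_solvable_subspace:
  assumes "lie_solvable L" "cop.subspace K" "K \<subseteq> L"
  shows "lie_solvable K"
proof -
  obtain n where "(lie_derived ^^ n) L = {0}" using assms(1) by (auto simp: lie_solvable_def)
  then have "(lie_derived ^^ n) K \<subseteq> {0}" using lie_derived_funpow_mono[OF assms(3), of n] by simp
  moreover have "0 \<in> (lie_derived ^^ n) K"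
    by (rule cop.subspace_0[OF subspace_lie_derived_funpow[OF assms(2)]])
  ultimately show ?thesis unfolding lie_solvable_def by blast
qed

lemma fin_dim_subspace:
  assumes "fin_dim L" "cop.subspace K" "K \<subseteq> L"
  shows "fin_dim K"
proof -
  obtain A where A: "finite A" "cop.span A = L" using assms(1) by (auto simp: fin_dim_def)
  obtain B where B: "B \<subseteq> K" "cop.independent B" "K \<subseteq> cop.span B"
    using cop.basis_exists[of K] by metis
  have "finite B" using cop.independent_span_bound[of A B] A B assms by auto
  moreover have "cop.span B = K" using B cop.span_minimal[OF B(1) assms(2)] by auto
  ultimately show ?thesis by (auto simp: fin_dim_def)
qed

abbreviation subspace_sum :: "('a::complex_banach \<Rightarrow>\<^sub>L 'a) set \<Rightarrow> ('a \<Rightarrow>\<^sub>L 'a) set \<Rightarrow> ('a \<Rightarrow>\<^sub>L 'a) set"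
  where "subspace_sum I J \<equiv> {S + T | S T. S \<in> I \<and> T \<in> J}"

lemma fin_dim_sum:
  assumes "fin_dim I" "fin_dim J"
  shows "fin_dim (subspace_sum I J)"
proof -
  obtain A B where "finite A" "cop.span A = I" "finite B" "cop.span B = J"
    using assms by (auto simp: fin_dim_def)
  then show ?thesis
    unfolding fin_dim_def by (intro exI[of _ "A \<union> B"]) (auto simp: cop.span_Un)
qed

lemma lie_ideal_sum:
  assumes "lie_ideal I L" "lie_ideal J L" "lie_algebra L"
  shows "lie_ideal (subspace_sum I J) L"
proof -
  have "cop.subspace (subspace_sum I J)"
    using cop.subspace_sums assms by (auto simp: lie_ideal_def)
  moreover have "subspace_sum I J \<subseteq> L"
    using assms cop.subspace_add[of L] by (auto simp: lie_ideal_def lie_algebra_def subset_iff)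
  moreover have "lie_bracket S T \<in> subspace_sum I J" if "S \<in> L" "T \<in> subspace_sum I J" for S T
    using that lie_bracket_ideal(1)[OF assms(1)] lie_bracket_ideal(1)[OF assms(2)]
    by (force simp: lie_bracket_add_right)
  ultimately show ?thesis by (simp add: lie_ideal_def)
qed

text \<open>
  Modulo \<open>J\<close> the derived series of \<open>I + J\<close> is the image of that of \<open>I\<close>, so it enters \<open>J\<close> after finitely many
  steps; from there on it is dominated by the derived series of \<open>J\<close>.
\<close>
lemma lie_solvable_sum:
  assumes L: "lie_algebra L" and I: "lie_ideal I L" "lie_solvable I"
    and J: "lie_ideal J L" "lie_solvable J"
  shows "lie_solvable (subspace_sum I J)"
proof -
  let ?D = "\<lambda>n. (lie_derived ^^ n) I"
  have subI: "cop.subspace I" and subJ: "cop.subspace J" and "I \<subseteq> L" "J \<subseteq> L"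
    using I J by (auto simp: lie_ideal_def)
  have algI: "lie_algebra I" by (rule lie_ideal_imp_lie_algebra[OF L I(1)])
  have step: "(lie_derived ^^ n) (subspace_sum I J) \<subseteq> subspace_sum (?D n) J" for n
  proof (induction n)
    case (Suc n)
    have "lie_bracket U V \<in> subspace_sum (?D (Suc n)) J"
      if UV: "U \<in> subspace_sum (?D n) J" "V \<in> subspace_sum (?D n) J" for U V
    proof -
      obtain S S' T T' where *: "U = S + T" "V = S' + T'" "S \<in> ?D n" "S' \<in> ?D n" "T \<in> J" "T' \<in> J"
        using UV by auto
      have inL: "S \<in> L" "S' \<in> L" "T \<in> L"
        using * lie_derived_funpow_subset[OF algI, of n] \<open>I \<subseteq> L\<close> \<open>J \<subseteq> L\<close> by auto
      have "lie_bracket U V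
          = lie_bracket S S' + (lie_bracket S T' + lie_bracket T S' + lie_bracket T T')"
        by (simp add: * lie_bracket_add_left lie_bracket_add_right)
      moreover have "lie_bracket S S' \<in> ?D (Suc n)"
        using * by (auto simp: lie_derived_def intro!: cop.span_base)
      moreover have "lie_bracket S T' + lie_bracket T S' + lie_bracket T T' \<in> J"
        using * inL lie_bracket_ideal[OF J(1)] subJ by (intro cop.subspace_add) auto
      ultimately show ?thesis by blast
    qed
    then have "lie_derived (subspace_sum (?D n) J) \<subseteq> subspace_sum (?D (Suc n)) J"
      unfolding lie_derived_def[of "subspace_sum (?D n) J"]
      using cop.subspace_sums[OF subspace_lie_derived_funpow[OF subI, of "Suc n"] subJ]
      by (intro cop.span_minimal) blast+
    then show ?case using lie_derived_mono[OF Suc] by simp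
  qed auto
  obtain m n where m: "?D m = {0}" and n: "(lie_derived ^^ n) J = {0}"
    using I J by (auto simp: lie_solvable_def)
  have "(lie_derived ^^ m) (subspace_sum I J) \<subseteq> J" using step[of m] m by simp
  then have "(lie_derived ^^ (n + m)) (subspace_sum I J) \<subseteq> {0}"
    using lie_derived_funpow_mono[of "(lie_derived ^^ m) (subspace_sum I J)" J n] n
    by (simp add: funpow_add)
  moreover have "0 \<in> (lie_derived ^^ (n + m)) (subspace_sum I J)"
    by (intro cop.subspace_0 subspace_lie_derived_funpow cop.subspace_sums subI subJ)
  ultimately show ?thesis unfolding lie_solvable_def by blast
qed

lemma fs_ideals_sum:
  assumes "lie_algebra L" "I \<in> fs_ideals L" "J \<in> fs_ideals L"
  shows "subspace_sum I J \<in> fs_ideals L"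
  using assms lie_ideal_sum[of I L J] lie_solvable_sum[of L I J] fin_dim_sum[of I J]
  by (simp add: fs_ideals_def)

lemma fs_ideals_directed:
  assumes "lie_algebra L" "I \<in> fs_ideals L" "J \<in> fs_ideals L"
  shows "\<exists>K\<in>fs_ideals L. I \<subseteq> K \<and> J \<subseteq> K"
proof (intro bexI conjI)
  show "subspace_sum I J \<in> fs_ideals L" by (rule fs_ideals_sum[OF assms])
  have "0 \<in> I" "0 \<in> J"
    using assms cop.subspace_0 by (auto simp: fs_ideals_def lie_ideal_def)
  then show "I \<subseteq> subspace_sum I J" "J \<subseteq> subspace_sum I J"
    by (force intro: exI[of _ 0])+
qed

lemma fs_idealsD:
  assumes "I \<in> fs_ideals L"
  shows "lie_ideal I L" "lie_solvable I" "fin_dim I" "cop.subspace I" "I \<subseteq> L"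
  using assms by (auto simp: fs_ideals_def lie_ideal_def)

lemma zero_lie_ideal: "lie_algebra L \<Longrightarrow> lie_ideal {0} L"
  by (auto simp: lie_ideal_def lie_algebra_def lie_bracket_zero_right cop.subspace_0)

lemma zero_fs_ideal: "lie_algebra L \<Longrightarrow> {0} \<in> fs_ideals L"
  unfolding fs_ideals_def
  by (auto simp: zero_lie_ideal lie_solvable_def fin_dim_def intro: exI[of _ "0::nat"] exI[of _ "{}"])

text \<open>
  A finite sum of elements of ideals lies in the sum of these ideals, which is itself one of the
  ideals considered; so finite sums over an arbitrary subfamily reduce to single ideals.
\<close>
lemma quasi_solvable_iff:
  "quasi_solvable L \<longleftrightarrow> lie_algebra L \<and> L \<subseteq> \<Union>(fs_ideals L)"
proof
  assume "quasi_solvable L"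
  then obtain F where L: "lie_algebra L" and F: "F \<subseteq> fs_ideals L"
    and eq: "L = {\<Sum>I\<in>G. v I | G v. finite G \<and> G \<subseteq> F \<and> (\<forall>I\<in>G. v I \<in> I)}"
    unfolding quasi_solvable_def by blast
  have sums: "\<exists>J\<in>fs_ideals L. (\<Sum>I\<in>G. v I) \<in> J" if "finite G" "G \<subseteq> F" "\<forall>I\<in>G. v I \<in> I" for G v
    using that
  proof (induction G rule: finite_induct)
    case empty
    show ?case using zero_fs_ideal[OF L] by auto
  next
    case (insert I G)
    then obtain J where J: "J \<in> fs_ideals L" "(\<Sum>I\<in>G. v I) \<in> J" by auto
    have "I \<in> fs_ideals L" using insert F by auto
    then have sum_ideal: "subspace_sum I J \<in> fs_ideals L" by (rule fs_ideals_sum[OF L _ J(1)])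
    have sum_eq: "(\<Sum>I\<in>insert I G. v I) = v I + (\<Sum>I\<in>G. v I)" and "v I \<in> I"
      using insert by simp_all
    have "(\<Sum>I\<in>insert I G. v I) \<in> subspace_sum I J"
      unfolding sum_eq using \<open>v I \<in> I\<close> J(2)
      by (intro CollectI exI[of _ "v I"] exI[of _ "\<Sum>I\<in>G. v I"] conjI refl)
    then show ?case using sum_ideal by (rule bexI)
  qed
  have "T \<in> \<Union>(fs_ideals L)" if T: "T \<in> L" for T
  proof -
    obtain G v where T_eq: "T = (\<Sum>I\<in>G. v I)" and G: "finite G" "G \<subseteq> F" "\<forall>I\<in>G. v I \<in> I"
      using T[unfolded eq] by (elim CollectE exE conjE)
    show ?thesis unfolding T_eq Union_iff by (rule sums[OF G])
  qed
  then show "lie_algebra L \<and> L \<subseteq> \<Union>(fs_ideals L)" using L by (intro conjI subsetI)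
next
  assume *: "lie_algebra L \<and> L \<subseteq> \<Union>(fs_ideals L)"
  have "L = {\<Sum>I\<in>G. v I | G v. finite G \<and> G \<subseteq> fs_ideals L \<and> (\<forall>I\<in>G. v I \<in> I)}" (is "_ = ?S")
  proof (intro equalityI subsetI)
    fix T assume "T \<in> L"
    then obtain J where J: "J \<in> fs_ideals L" "T \<in> J" using * by blast
    show "T \<in> ?S" by (rule CollectI, rule exI[of _ "{J}"], rule exI[of _ "\<lambda>_. T"]) (simp add: J)
  next
    fix T assume "T \<in> ?S"
    then obtain G v where G: "T = (\<Sum>I\<in>G. v I)" "G \<subseteq> fs_ideals L" "\<forall>I\<in>G. v I \<in> I" by blast
    have "v I \<in> L" if "I \<in> G" for I
      using G that fs_idealsD(5)[of I L] by blast
    then show "T \<in> L"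
      unfolding G(1) using * by (intro cop.subspace_sum) (simp_all add: lie_algebra_def)
  qed
  then show "quasi_solvable L"
    unfolding quasi_solvable_def
    by (intro conjI[OF conjunct1[OF *]] exI[of _ "fs_ideals L"] conjI[OF order_refl])
qed

text \<open>
  With \<open>H = M\<close> this makes subalgebras of quasi-solvable algebras quasi-solvable; with \<open>M = L\<close> it
  supplies the ideals \<open>H \<inter> I\<close> through which spectra over \<open>H\<close> and over \<open>L\<close> are compared.
\<close>
lemma fs_ideals_Int:
  assumes "lie_algebra M" "M \<subseteq> L" "I \<in> fs_ideals L" "lie_ideal H M"
  shows "H \<inter> I \<in> fs_ideals M"
proof -
  note I = fs_idealsD[OF assms(3)]
  have sub: "cop.subspace (H \<inter> I)"
    using assms I by (intro cop.subspace_inter) (auto simp: lie_ideal_def)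
  have "lie_ideal (H \<inter> I) M"
    using sub assms I by (auto simp: lie_ideal_def)
  then show ?thesis
    using lie_solvable_subspace[OF I(2) sub] fin_dim_subspace[OF I(3) sub]
    by (auto simp: fs_ideals_def)
qed

lemma lie_ideal_self: "lie_algebra L \<Longrightarrow> lie_ideal L L"
  by (simp add: lie_algebra_def lie_ideal_def)

lemma quasi_solvable_subalgebra:
  assumes "quasi_solvable L" "lie_subalgebra M L"
  shows "quasi_solvable M"
proof -
  have M: "lie_algebra M" "M \<subseteq> L" using assms by (auto simp: lie_subalgebra_def)
  have "T \<in> \<Union>(fs_ideals M)" if T: "T \<in> M" for T
  proof -
    obtain I where "I \<in> fs_ideals L" "T \<in> I" using assms M T by (auto simp: quasi_solvable_iff)
    then show ?thesis using fs_ideals_Int[OF M _ lie_ideal_self[OF M(1)]] T by blast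
  qed
  then show ?thesis using M by (auto simp: quasi_solvable_iff)
qed

lemma fs_ideals_finite_cover:
  assumes "quasi_solvable L" "finite B" "B \<subseteq> L"
  shows "\<exists>I\<in>fs_ideals L. B \<subseteq> I"
  using assms(2,3)
proof (induction B rule: finite_induct)
  case empty
  show ?case using zero_fs_ideal assms(1) by (auto simp: quasi_solvable_iff)
next
  case (insert T B)
  then obtain I where I: "I \<in> fs_ideals L" "B \<subseteq> I" by auto
  obtain J where J: "J \<in> fs_ideals L" "T \<in> J"
    using assms(1) insert by (auto simp: quasi_solvable_iff)
  have "lie_algebra L" using assms(1) by (simp add: quasi_solvable_iff)
  then obtain K where "K \<in> fs_ideals L" "I \<subseteq> K" "J \<subseteq> K"
    using fs_ideals_directed[OF _ I(1) J(1)] by blast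
  with I(2) J(2) show ?case by blast
qed

lemma fin_dim_subset_fs_ideal:
  assumes "quasi_solvable L" "fin_dim K" "K \<subseteq> L"
  obtains I where "I \<in> fs_ideals L" "K \<subseteq> I"
proof -
  obtain B where B: "finite B" "cop.span B = K" using assms by (auto simp: fin_dim_def)
  then obtain I where I: "I \<in> fs_ideals L" "B \<subseteq> I"
    using fs_ideals_finite_cover[OF assms(1), of B] assms(3) cop.span_superset[of B] by blast
  with B have "K \<subseteq> I" using cop.span_minimal[OF I(2) fs_idealsD(4)] by auto
  with I that show thesis by blast
qed

section \<open>The product of the spectra of the ideals\<close>

lemma compact_space_directed_Inter:
  assumes "compact_space X" "A \<noteq> {}"
    and closed: "\<And>J. J \<in> A \<Longrightarrow> closedin X (C J)"
    and ne: "\<And>J. J \<in> A \<Longrightarrow> C J \<noteq> {}"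
    and dir: "\<And>I J. \<lbrakk>I \<in> A; J \<in> A\<rbrakk> \<Longrightarrow> \<exists>K\<in>A. C K \<subseteq> C I \<inter> C J"
  shows "\<exists>x. \<forall>J\<in>A. x \<in> C J"
proof -
  have below: "\<exists>K\<in>A. C K \<subseteq> \<Inter>(C ` B)" if "finite B" "B \<subseteq> A" for B
    using that
  proof (induction B rule: finite_induct)
    case empty
    show ?case using assms(2) by auto
  next
    case (insert J B)
    then obtain K where "K \<in> A" "C K \<subseteq> \<Inter>(C ` B)" by auto
    moreover from this(1) obtain K' where "K' \<in> A" "C K' \<subseteq> C K \<inter> C J"
      using dir[of K J] insert(4) by blast
    ultimately show ?case by (intro bexI[of _ K']) auto
  qed
  have "\<Inter>\<F> \<noteq> {}" if \<F>: "finite \<F>" "\<F> \<subseteq> C ` A" for \<F>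
  proof -
    obtain B where "finite B" "B \<subseteq> A" "\<F> = C ` B" using finite_subset_image[OF \<F>] by metis
    with below[of B] ne show ?thesis by (metis subset_empty)
  qed
  then have "\<Inter>(C ` A) \<noteq> {}"
    using assms(1) closed unfolding compact_space_fip by (auto dest!: spec[of _ "C ` A"])
  then show ?thesis by auto
qed

abbreviation spectra_topology where
  "spectra_topology \<sigma> L \<equiv>
    product_topology (\<lambda>I. subtopology (dual_topology I) (\<sigma> I)) (fs_ideals L)"

abbreviation ideal_restrictions where
  "ideal_restrictions L f \<equiv> (\<lambda>I\<in>fs_ideals L. restrict f I)"

text \<open>The inverse limit of the sets \<open>\<sigma> I\<close> under restriction, realised by functionals on \<open>L\<close>.\<close>
definition limit_spectrum where
  "limit_spectrum \<sigma> L = {f \<in> extensional L. \<forall>I\<in>fs_ideals L. restrict f I \<in> \<sigma> I}"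

lemma joint_spectrumD:
  assumes "joint_spectrum \<sigma>" "lie_algebra L" "I \<in> fs_ideals L"
  shows "\<sigma> I \<subseteq> characters I" "\<sigma> I \<noteq> {}" "compactin (dual_topology I) (\<sigma> I)"
    and "lie_ideal H I \<Longrightarrow> (\<lambda>f. restrict f H) ` \<sigma> I = \<sigma> H"
  using assms fs_idealsD[OF assms(3)] lie_ideal_imp_lie_algebra[of L I]
  unfolding joint_spectrum_def by blast+

lemma lie_ideal_subset:
  "\<lbrakk>lie_ideal I L; I \<subseteq> J; J \<subseteq> L\<rbrakk> \<Longrightarrow> lie_ideal I J"
  by (auto simp: lie_ideal_def)

lemma topspace_spectra_topology:
  assumes "joint_spectrum \<sigma>" "lie_algebra L"
  shows "topspace (spectra_topology \<sigma> L) = (\<Pi>\<^sub>E I\<in>fs_ideals L. \<sigma> I)"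
  using compactin_subset_topspace[OF joint_spectrumD(3)[OF assms]]
  by (force intro!: PiE_cong)

lemma compact_spectra_topology:
  assumes "joint_spectrum \<sigma>" "lie_algebra L"
  shows "compact_space (spectra_topology \<sigma> L)"
  using joint_spectrumD(3)[OF assms]
  by (auto simp: compact_space_product_topology intro: compact_space_subtopology)

lemma Hausdorff_dual_topology: "Hausdorff_space (dual_topology L)"
  unfolding dual_topology_def
  by (intro Hausdorff_space_subtopology) (simp add: Hausdorff_space_product_topology)

lemma Hausdorff_spectra_topology: "Hausdorff_space (spectra_topology \<sigma> L)"
  by (simp add: Hausdorff_space_product_topology Hausdorff_space_subtopology Hausdorff_dual_topology)

lemma continuous_map_evaluation:
  assumes "J \<in> fs_ideals L" "T \<in> J"
  shows "continuous_map (spectra_topology \<sigma> L) euclidean (\<lambda>\<phi>. \<phi> J T)"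
proof -
  have "continuous_map (subtopology (dual_topology J) (\<sigma> J)) euclidean (\<lambda>f. f T)"
    unfolding dual_topology_def
    by (intro continuous_map_from_subtopology continuous_map_product_projection assms(2))
  with continuous_map_product_projection[OF assms(1)] show ?thesis
    using continuous_map_compose[of _ _ "\<lambda>\<phi>. \<phi> J" euclidean "\<lambda>f. f T"] by (fastforce simp: o_def)
qed

text \<open>
  The inverse limit inside the product is the intersection of these sets over all \<open>J\<close>. They
  decrease as \<open>J\<close> grows, and each one constrains only the components below \<open>J\<close>: any element of
  \<open>\<sigma> J\<close> determines those, while the other components remain free.
\<close>
definition coherent_below where
  "coherent_below \<sigma> L J =
    {\<phi> \<in> topspace (spectra_topology \<sigma> L). \<forall>I\<in>fs_ideals L. I \<subseteq> J \<longrightarrow> (\<forall>T\<in>I. \<phi> J T = \<phi> I T)}"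

lemma coherent_belowD:
  "\<lbrakk>\<phi> \<in> coherent_below \<sigma> L J; I \<in> fs_ideals L; I \<subseteq> J; T \<in> I\<rbrakk> \<Longrightarrow> \<phi> J T = \<phi> I T"
  by (simp add: coherent_below_def)

lemma closedin_agree:
  assumes "J \<in> fs_ideals L" "K \<subseteq> J"
  shows "closedin (spectra_topology \<sigma> L)
    {\<phi> \<in> topspace (spectra_topology \<sigma> L). \<forall>T\<in>K. \<phi> J T = g T}"
proof -
  have "closedin (spectra_topology \<sigma> L) {\<phi> \<in> topspace (spectra_topology \<sigma> L). \<phi> J T = g T}"
    if "T \<in> K" for T
    using that assms
    by (intro closedin_continuous_maps_eq[of euclidean] continuous_map_evaluation) auto
  then have "closedin (spectra_topology \<sigma> L)
      (\<Inter>(insert (topspace (spectra_topology \<sigma> L))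
        ((\<lambda>T. {\<phi> \<in> topspace (spectra_topology \<sigma> L). \<phi> J T = g T}) ` K)))"
    by (intro closedin_Inter) (auto simp del: topspace_product_topology)
  then show ?thesis by (rule back_subst) auto
qed

lemma closedin_coherent_below:
  assumes "J \<in> fs_ideals L"
  shows "closedin (spectra_topology \<sigma> L) (coherent_below \<sigma> L J)"
proof -
  let ?X = "spectra_topology \<sigma> L"
  let ?S = "{(I, T). I \<in> fs_ideals L \<and> I \<subseteq> J \<and> T \<in> I}"
  have "closedin ?X {\<phi> \<in> topspace ?X. \<phi> J T = \<phi> I T}" if "(I, T) \<in> ?S" for I T
    using that assms by (intro closedin_continuous_maps_eq[of euclidean] continuous_map_evaluation) auto
  then have "closedin ?X
      (\<Inter>(insert (topspace ?X) ((\<lambda>(I, T). {\<phi> \<in> topspace ?X. \<phi> J T = \<phi> I T}) ` ?S)))"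
    by (intro closedin_Inter) (auto simp del: topspace_product_topology)
  then show ?thesis by (rule back_subst) (auto simp: coherent_below_def)
qed

lemma coherent_below_antimono:
  assumes "I \<in> fs_ideals L" "I \<subseteq> J"
  shows "coherent_below \<sigma> L J \<subseteq> coherent_below \<sigma> L I"
proof
  fix \<phi> assume *: "\<phi> \<in> coherent_below \<sigma> L J"
  have "\<phi> I T = \<phi> K T" if "K \<in> fs_ideals L" "K \<subseteq> I" "T \<in> K" for K T
  proof -
    have "K \<subseteq> J" "T \<in> I" using that assms by auto
    then show ?thesis
      using coherent_belowD[OF * assms] coherent_belowD[OF * that(1)] that(3) by metis
  qed
  with * show "\<phi> \<in> coherent_below \<sigma> L I" by (auto simp: coherent_below_def)
qed

section \<open>The inverse limit as a set of characters\<close>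

text \<open>
  The members of \<open>\<phi>\<close> on two ideals agree on their intersection, because both are restrictions of the
  member on an ideal containing the two; and the ideals cover \<open>L\<close>.
\<close>
lemma coherent_family_glue:
  assumes js: "joint_spectrum \<sigma>" and L: "quasi_solvable L"
    and coh: "\<And>J. J \<in> fs_ideals L \<Longrightarrow> \<phi> \<in> coherent_below \<sigma> L J"
  obtains f where "f \<in> limit_spectrum \<sigma> L" "ideal_restrictions L f = \<phi>"
proof -
  have alg: "lie_algebra L" using L by (simp add: quasi_solvable_iff)
  have "\<phi> \<in> topspace (spectra_topology \<sigma> L)"
    using coh[OF zero_fs_ideal[OF alg]] by (auto simp: coherent_below_def)
  then have \<phi>: "\<phi> \<in> (\<Pi>\<^sub>E I\<in>fs_ideals L. \<sigma> I)" by (simp only: topspace_spectra_topology[OF js alg])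
  have agree: "\<phi> I T = \<phi> J T" if IJ: "I \<in> fs_ideals L" "J \<in> fs_ideals L" "T \<in> I" "T \<in> J" for I J T
  proof -
    obtain K where K: "K \<in> fs_ideals L" "I \<subseteq> K" "J \<subseteq> K"
      using fs_ideals_directed[OF alg IJ(1,2)] by blast
    have "\<phi> K T = \<phi> I T" by (rule coherent_belowD[OF coh[OF K(1)] IJ(1) K(2) IJ(3)])
    moreover have "\<phi> K T = \<phi> J T" by (rule coherent_belowD[OF coh[OF K(1)] IJ(2) K(3) IJ(4)])
    ultimately show ?thesis by simp
  qed
  define f where "f = (\<lambda>T\<in>L. \<phi> (SOME I. I \<in> fs_ideals L \<and> T \<in> I) T)"
  have f_eq: "f T = \<phi> I T" if I: "I \<in> fs_ideals L" "T \<in> I" for I T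
  proof -
    have "(SOME I. I \<in> fs_ideals L \<and> T \<in> I) \<in> fs_ideals L \<and> T \<in> (SOME I. I \<in> fs_ideals L \<and> T \<in> I)"
      by (rule someI[of _ I]) (use I in simp)
    then have "\<phi> (SOME I. I \<in> fs_ideals L \<and> T \<in> I) T = \<phi> I T" using agree I by blast
    moreover have "T \<in> L" using I fs_idealsD(5) by blast
    ultimately show ?thesis by (simp add: f_def)
  qed
  have restr: "restrict f I = \<phi> I" if I: "I \<in> fs_ideals L" for I
  proof -
    have "\<phi> I \<in> \<sigma> I" using \<phi> I by auto
    then have "\<phi> I \<in> extensional I"
      using joint_spectrumD(1)[OF js alg I] by (auto simp: characters_def lie_dual_def)
    then show ?thesis using f_eq[OF I] by (intro extensionalityI[of _ I]) auto
  qed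
  have "f \<in> limit_spectrum \<sigma> L"
    using \<phi> restr by (auto simp: limit_spectrum_def f_def)
  moreover have "ideal_restrictions L f = \<phi>"
    using \<phi> restr by (intro extensionalityI[of _ "fs_ideals L"]) (auto simp: PiE_def)
  ultimately show thesis by (rule that)
qed

lemma ideal_restrictions_coherent:
  assumes "joint_spectrum \<sigma>" "lie_algebra L" "f \<in> limit_spectrum \<sigma> L" "J \<in> fs_ideals L"
  shows "ideal_restrictions L f \<in> coherent_below \<sigma> L J"
proof -
  have "ideal_restrictions L f \<in> topspace (spectra_topology \<sigma> L)"
    unfolding topspace_spectra_topology[OF assms(1,2)]
    using assms(3) by (auto simp: limit_spectrum_def)
  then show ?thesis using assms(4) by (auto simp: coherent_below_def)
qed

lemma limit_spectrum_compact:
  assumes js: "joint_spectrum \<sigma>" and L: "quasi_solvable L"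
  shows "compactin (spectra_topology \<sigma> L) (ideal_restrictions L ` limit_spectrum \<sigma> L)"
proof -
  have alg: "lie_algebra L" using L by (simp add: quasi_solvable_iff)
  have "ideal_restrictions L ` limit_spectrum \<sigma> L = \<Inter>(coherent_below \<sigma> L ` fs_ideals L)"
  proof (intro equalityI subsetI)
    fix \<phi> assume "\<phi> \<in> \<Inter>(coherent_below \<sigma> L ` fs_ideals L)"
    then obtain f where "f \<in> limit_spectrum \<sigma> L" "ideal_restrictions L f = \<phi>"
      using coherent_family_glue[OF js L] by (metis INT_E)
    then show "\<phi> \<in> ideal_restrictions L ` limit_spectrum \<sigma> L" by blast
  next
    fix \<phi> assume "\<phi> \<in> ideal_restrictions L ` limit_spectrum \<sigma> L"
    then obtain f where f: "f \<in> limit_spectrum \<sigma> L" "\<phi> = ideal_restrictions L f" by (rule imageE)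
    show "\<phi> \<in> \<Inter>(coherent_below \<sigma> L ` fs_ideals L)"
      unfolding f(2) by (intro INT_I ideal_restrictions_coherent[OF js alg f(1)])
  qed
  moreover have "closedin (spectra_topology \<sigma> L) (\<Inter>(coherent_below \<sigma> L ` fs_ideals L))"
    using zero_fs_ideal[OF alg] closedin_coherent_below by (intro closedin_Inter) auto
  ultimately show ?thesis
    using closedin_compact_space[OF compact_spectra_topology[OF js alg]] by simp
qed

text \<open>
  Any two operators of \<open>L\<close> lie in a common ideal \<open>I\<close>, and \<open>f\<close> is a character there. In particular
  their commutator is a commutator of elements of \<open>I\<close>.
\<close>
lemma limit_spectrum_characters:
  assumes js: "joint_spectrum \<sigma>" and L: "quasi_solvable L"
  shows "limit_spectrum \<sigma> L \<subseteq> characters L"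
proof
  fix f assume f: "f \<in> limit_spectrum \<sigma> L"
  have alg: "lie_algebra L" using L by (simp add: quasi_solvable_iff)
  have char: "restrict f I \<in> characters I" if "I \<in> fs_ideals L" for I
    using f that joint_spectrumD(1)[OF js alg that] by (auto simp: limit_spectrum_def)
  have local: "f (S + T) = f S + f T" "f (scaleC_blinfun c T) = c * f T" "f (lie_bracket S T) = 0"
    if ST: "S \<in> L" "T \<in> L" for S T c
  proof -
    obtain I where I: "I \<in> fs_ideals L" "S \<in> I" "T \<in> I"
      using fs_ideals_finite_cover[OF L, of "{S, T}"] ST by auto
    note sub = fs_idealsD(4)[OF I(1)]
    have "S + T \<in> I" "scaleC_blinfun c T \<in> I"
      using I sub by (auto intro: cop.subspace_add cop.subspace_scale)
    moreover have "restrict f I (S + T) = restrict f I S + restrict f I T"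
      "restrict f I (scaleC_blinfun c T) = c * restrict f I T"
      using char[OF I(1)] I(2,3) unfolding characters_def lie_dual_def by blast+
    ultimately show "f (S + T) = f S + f T" "f (scaleC_blinfun c T) = c * f T"
      using I by simp_all
    have "lie_bracket S T \<in> I" using lie_bracket_ideal(1)[OF fs_idealsD(1)[OF I(1)] ST(1) I(3)] .
    moreover have "lie_bracket S T \<in> lie_derived I"
      using I by (auto simp: lie_derived_def intro!: cop.span_base)
    ultimately show "f (lie_bracket S T) = 0" using char[OF I(1)] by (auto simp: characters_def)
  qed
  have "cop.subspace L" using alg by (simp add: lie_algebra_def)
  then have "cop.subspace {T \<in> L. f T = 0}"
    using local(1)[of 0 0] by (auto simp: cop.subspace_def local)
  then have "lie_derived L \<subseteq> {T \<in> L. f T = 0}"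
    unfolding lie_derived_def using local(3) alg
    by (intro cop.span_minimal) (auto simp: lie_algebra_def)
  then show "f \<in> characters L"
    using f local by (auto simp: characters_def lie_dual_def limit_spectrum_def)
qed

lemma restrict_restrict_subset: "K \<subseteq> H \<Longrightarrow> restrict (restrict f H) K = restrict f K"
  by (simp add: Int_absorb1)

lemma limit_spectrum_fin_dim:
  assumes js: "joint_spectrum \<sigma>" and H: "lie_algebra H" "lie_solvable H" "fin_dim H"
  shows "limit_spectrum \<sigma> H = \<sigma> H"
proof
  have self: "H \<in> fs_ideals H" using H lie_ideal_self by (auto simp: fs_ideals_def)
  show "limit_spectrum \<sigma> H \<subseteq> \<sigma> H"
  proof
    fix f assume "f \<in> limit_spectrum \<sigma> H"
    then have "f \<in> extensional H" "restrict f H \<in> \<sigma> H" using self by (simp_all add: limit_spectrum_def)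
    then show "f \<in> \<sigma> H" by (simp add: extensional_restrict)
  qed
  have "restrict f I \<in> \<sigma> I" if "f \<in> \<sigma> H" "I \<in> fs_ideals H" for f I
    using joint_spectrumD(4)[OF js H(1) self fs_idealsD(1)[OF that(2)]] that by blast
  moreover have "\<sigma> H \<subseteq> extensional H"
    using joint_spectrumD(1)[OF js H(1) self] by (auto simp: characters_def lie_dual_def)
  ultimately show "\<sigma> H \<subseteq> limit_spectrum \<sigma> H" by (auto simp: limit_spectrum_def)
qed

section \<open>The projection property\<close>

text \<open>
  An ideal \<open>K\<close> of \<open>H\<close> is in general not an ideal of \<open>M\<close>. The detour is through \<open>H \<inter> I\<close>, where
  \<open>I\<close> is an ideal of \<open>M\<close> containing \<open>K\<close>: it is an ideal of \<open>M\<close> and has \<open>K\<close> as an ideal.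
\<close>
lemma limit_spectrum_restrict:
  assumes js: "joint_spectrum \<sigma>" and M: "quasi_solvable M" and H: "lie_ideal H M"
    and f: "f \<in> limit_spectrum \<sigma> M"
  shows "restrict f H \<in> limit_spectrum \<sigma> H"
proof -
  have alg: "lie_algebra M" using M by (simp add: quasi_solvable_iff)
  have HM: "H \<subseteq> M" using H by (simp add: lie_ideal_def)
  have "restrict f K \<in> \<sigma> K" if K: "K \<in> fs_ideals H" for K
  proof -
    note KH = fs_idealsD[OF K]
    obtain I where I: "I \<in> fs_ideals M" "K \<subseteq> I"
      using fin_dim_subset_fs_ideal[OF M KH(3)] KH(5) HM by blast
    have HI: "H \<inter> I \<in> fs_ideals M" by (rule fs_ideals_Int[OF alg order_refl I(1) H])
    have "lie_ideal K (H \<inter> I)" using lie_ideal_subset[OF KH(1)] I KH(5) by auto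
    from joint_spectrumD(4)[OF js alg HI this] have "restrict (restrict f (H \<inter> I)) K \<in> \<sigma> K"
      using f HI by (auto simp only: limit_spectrum_def mem_Collect_eq)
    moreover have "K \<subseteq> H \<inter> I" using I KH(5) by auto
    ultimately show ?thesis by (metis restrict_restrict_subset)
  qed
  then have "restrict (restrict f H) K \<in> \<sigma> K" if "K \<in> fs_ideals H" for K
    using restrict_restrict_subset[OF fs_idealsD(5)[OF that], of f] that by simp
  then show ?thesis by (simp add: limit_spectrum_def del: restrict_restrict)
qed

text \<open>
  The sets \<open>C J\<close> in the proof consist of the families that are coherent below \<open>J\<close> and agree with \<open>g\<close> on
  \<open>H \<inter> J\<close>. They are closed and directed, and nonempty because \<open>\<sigma> J\<close> projects onto
  \<open>\<sigma> (H \<inter> J)\<close>, which contains the restriction of \<open>g\<close>.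
\<close>
lemma limit_spectrum_extend:
  assumes js: "joint_spectrum \<sigma>" and M: "quasi_solvable M" and H: "lie_ideal H M"
    and g: "g \<in> limit_spectrum \<sigma> H"
  obtains f where "f \<in> limit_spectrum \<sigma> M" "restrict f H = g"
proof -
  have alg: "lie_algebra M" using M by (simp add: quasi_solvable_iff)
  have HM: "H \<subseteq> M" using H by (simp add: lie_ideal_def)
  have algH: "lie_algebra H" by (rule lie_ideal_imp_lie_algebra[OF alg H])
  let ?X = "spectra_topology \<sigma> M"
  define C where "C J = coherent_below \<sigma> M J \<inter> {\<phi> \<in> topspace ?X. \<forall>T\<in>H \<inter> J. \<phi> J T = g T}" for J
  have "\<exists>\<phi>. \<forall>J\<in>fs_ideals M. \<phi> \<in> C J"
  proof (rule compact_space_directed_Inter[of ?X "fs_ideals M" C])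
    show "compact_space ?X" by (rule compact_spectra_topology[OF js alg])
    show "fs_ideals M \<noteq> {}" using zero_fs_ideal[OF alg] by blast
  next
    fix J assume J: "J \<in> fs_ideals M"
    then show "closedin ?X (C J)"
      unfolding C_def by (intro closedin_Int closedin_coherent_below closedin_agree) auto
    have "H \<inter> J \<in> fs_ideals H"
      by (rule fs_ideals_Int[OF algH HM J lie_ideal_self[OF algH]])
    then have "restrict g (H \<inter> J) \<in> \<sigma> (H \<inter> J)" using g by (auto simp only: limit_spectrum_def mem_Collect_eq)
    moreover have ideal: "lie_ideal (H \<inter> J) J"
      using lie_ideal_subset[OF fs_idealsD(1)[OF fs_ideals_Int[OF alg order_refl J H]]]
        fs_idealsD(5)[OF J] by auto
    ultimately have "restrict g (H \<inter> J) \<in> (\<lambda>f. restrict f (H \<inter> J)) ` \<sigma> J"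
      by (simp only: joint_spectrumD(4)[OF js alg J ideal])
    then obtain h where h: "h \<in> \<sigma> J" "restrict g (H \<inter> J) = restrict h (H \<inter> J)" by blast
    \<comment> \<open>Components not below \<open>J\<close> are not constrained by \<open>C J\<close>; any points of the spectra will do.\<close>
    define \<phi> where "\<phi> = (\<lambda>I\<in>fs_ideals M. if I \<subseteq> J then restrict h I else (SOME k. k \<in> \<sigma> I))"
    have ext: "h \<in> extensional J"
      using joint_spectrumD(1)[OF js alg J] h by (auto simp: characters_def lie_dual_def)
    have "\<phi> I \<in> \<sigma> I" if I: "I \<in> fs_ideals M" for I
    proof (cases "I \<subseteq> J")
      case True
      then have "lie_ideal I J"
        using lie_ideal_subset[OF fs_idealsD(1)[OF I]] fs_idealsD(5)[OF J] by blast
      then have "restrict h I \<in> \<sigma> I" using joint_spectrumD(4)[OF js alg J] h by blast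
      then show ?thesis using True I by (simp add: \<phi>_def)
    next
      case False
      then show ?thesis
        using I joint_spectrumD(2)[OF js alg I] by (simp add: \<phi>_def some_in_eq)
    qed
    then have "\<phi> \<in> topspace ?X"
      unfolding topspace_spectra_topology[OF js alg] by (auto simp: \<phi>_def)
    moreover have "h T = g T" if "T \<in> H \<inter> J" for T
      using fun_cong[OF h(2), of T] that by simp
    ultimately have "\<phi> \<in> C J"
      using J by (auto simp: C_def coherent_below_def \<phi>_def)
    then show "C J \<noteq> {}" by blast
  next
    fix I J assume IJ: "I \<in> fs_ideals M" "J \<in> fs_ideals M"
    obtain K where K: "K \<in> fs_ideals M" "I \<subseteq> K" "J \<subseteq> K"
      using fs_ideals_directed[OF alg IJ] by blast
    have "C K \<subseteq> C I'" if I': "I' \<in> fs_ideals M" "I' \<subseteq> K" for I'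
    proof
      fix \<phi> assume \<phi>: "\<phi> \<in> C K"
      then have "\<phi> \<in> coherent_below \<sigma> M I'"
        using coherent_below_antimono[OF I'] by (auto simp: C_def)
      moreover have "\<phi> I' T = g T" if "T \<in> H \<inter> I'" for T
      proof -
        have "\<phi> \<in> coherent_below \<sigma> M K" using \<phi> by (simp add: C_def)
        from coherent_belowD[OF this I'] have "\<phi> K T = \<phi> I' T" using that by blast
        moreover have "\<phi> K T = g T" using \<phi> I'(2) that unfolding C_def by blast
        ultimately show ?thesis by simp
      qed
      ultimately show "\<phi> \<in> C I'" by (auto simp: C_def coherent_below_def)
    qed
    with IJ K show "\<exists>K\<in>fs_ideals M. C K \<subseteq> C I \<inter> C J" by blast
  qed
  then obtain \<phi> where \<phi>: "\<And>J. J \<in> fs_ideals M \<Longrightarrow> \<phi> \<in> C J" by blast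
  have "\<phi> \<in> coherent_below \<sigma> M J" if "J \<in> fs_ideals M" for J using \<phi>[OF that] by (simp add: C_def)
  then obtain f where f: "f \<in> limit_spectrum \<sigma> M" "ideal_restrictions M f = \<phi>"
    using coherent_family_glue[OF js M] by metis
  have "f T = g T" if T: "T \<in> H" for T
  proof -
    obtain J where J: "J \<in> fs_ideals M" "T \<in> J" using M T HM by (auto simp: quasi_solvable_iff)
    then have "\<phi> J T = g T" using \<phi>[OF J(1)] T by (auto simp: C_def)
    then show ?thesis using J f(2) by auto
  qed
  moreover have "g \<in> extensional H" using g by (simp add: limit_spectrum_def)
  ultimately have "restrict f H = g" by (intro extensionalityI[of _ H]) auto
  with f(1) show thesis by (rule that)
qed

lemma limit_spectrum_projection:
  assumes "joint_spectrum \<sigma>" "quasi_solvable M" "lie_ideal H M"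
  shows "(\<lambda>f. restrict f H) ` limit_spectrum \<sigma> M = limit_spectrum \<sigma> H"
proof (intro equalityI subsetI)
  fix g assume "g \<in> limit_spectrum \<sigma> H"
  then show "g \<in> (\<lambda>f. restrict f H) ` limit_spectrum \<sigma> M"
    using limit_spectrum_extend[OF assms] by (metis image_eqI)
qed (use limit_spectrum_restrict[OF assms] in auto)

lemma limit_spectrum_nonempty:
  assumes js: "joint_spectrum \<sigma>" and L: "quasi_solvable L"
  shows "limit_spectrum \<sigma> L \<noteq> {}"
proof -
  have alg: "lie_algebra L" using L by (simp add: quasi_solvable_iff)
  have zero: "{0} \<in> fs_ideals L" by (rule zero_fs_ideal[OF alg])
  note D = fs_idealsD[OF zero]
  have "limit_spectrum \<sigma> {0} = \<sigma> {0}"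
    by (rule limit_spectrum_fin_dim[OF js lie_ideal_imp_lie_algebra[OF alg D(1)] D(2,3)])
  with joint_spectrumD(2)[OF js alg zero] limit_spectrum_projection[OF js L D(1)]
  show ?thesis by (metis image_empty)
qed

section \<open>Uniqueness\<close>

text \<open>
  Given \<open>f\<close> in the inverse limit, each ideal \<open>J\<close> admits an element of \<open>S\<close> that agrees with \<open>f\<close> on \<open>J\<close>.
  Compactness of \<open>S\<close> yields one element that does so for all \<open>J\<close> at once, and this is \<open>f\<close>.
\<close>
lemma compact_eq_limit_spectrum:
  assumes js: "joint_spectrum \<sigma>" and L: "quasi_solvable L"
    and ext: "S \<subseteq> extensional L"
    and comp: "compactin (spectra_topology \<sigma> L) (ideal_restrictions L ` S)"
    and proj: "\<And>I. I \<in> fs_ideals L \<Longrightarrow> (\<lambda>f. restrict f I) ` S = \<sigma> I"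
  shows "S = limit_spectrum \<sigma> L"
proof (intro equalityI subsetI)
  fix f assume "f \<in> S"
  then show "f \<in> limit_spectrum \<sigma> L" using ext proj by (auto simp: limit_spectrum_def)
next
  fix f assume f: "f \<in> limit_spectrum \<sigma> L"
  have alg: "lie_algebra L" and cover: "L \<subseteq> \<Union>(fs_ideals L)"
    using L by (auto simp: quasi_solvable_iff)
  let ?X = "spectra_topology \<sigma> L"
  define C where "C J = ideal_restrictions L ` S \<inter> {\<phi> \<in> topspace ?X. \<forall>T\<in>J. \<phi> J T = f T}" for J
  have sub: "ideal_restrictions L ` S \<subseteq> topspace ?X" by (rule compactin_subset_topspace[OF comp])
  have C_iff: "ideal_restrictions L h \<in> C J \<longleftrightarrow> (\<forall>T\<in>J. h T = f T)"
    if "h \<in> S" "J \<in> fs_ideals L" for h J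
    using that sub by (auto simp: C_def simp del: topspace_product_topology)
  have "\<exists>\<phi>. \<forall>J\<in>fs_ideals L. \<phi> \<in> C J"
  proof (rule compact_space_directed_Inter[of ?X "fs_ideals L" C])
    show "compact_space ?X" by (rule compact_spectra_topology[OF js alg])
    show "fs_ideals L \<noteq> {}" using zero_fs_ideal[OF alg] by blast
  next
    fix J assume J: "J \<in> fs_ideals L"
    then show "closedin ?X (C J)"
      unfolding C_def
      by (intro closedin_Int closedin_agree compactin_imp_closedin[OF Hausdorff_spectra_topology comp]) auto
    have "restrict f J \<in> \<sigma> J" using f J by (simp add: limit_spectrum_def)
    then obtain h where h: "h \<in> S" "restrict h J = restrict f J"
      using proj[OF J] by (metis imageE)
    then have "ideal_restrictions L h \<in> C J"
      using C_iff[OF h(1) J] by (metis restrict_apply')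
    then show "C J \<noteq> {}" by blast
  next
    fix I J assume IJ: "I \<in> fs_ideals L" "J \<in> fs_ideals L"
    obtain K where K: "K \<in> fs_ideals L" "I \<subseteq> K" "J \<subseteq> K"
      using fs_ideals_directed[OF alg IJ] by blast
    have "C K \<subseteq> C I \<inter> C J"
    proof
      fix \<phi> assume "\<phi> \<in> C K"
      moreover from this obtain h where "h \<in> S" "\<phi> = ideal_restrictions L h" by (auto simp: C_def)
      ultimately show "\<phi> \<in> C I \<inter> C J" using C_iff IJ K by blast
    qed
    with K show "\<exists>K\<in>fs_ideals L. C K \<subseteq> C I \<inter> C J" by blast
  qed
  then obtain \<phi> where \<phi>: "\<And>J. J \<in> fs_ideals L \<Longrightarrow> \<phi> \<in> C J" by blast
  obtain h where h: "h \<in> S" "\<phi> = ideal_restrictions L h"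
    using \<phi>[OF zero_fs_ideal[OF alg]] by (auto simp: C_def)
  have "h T = f T" if "T \<in> L" for T
    using \<phi> C_iff[OF h(1)] h(2) cover that by blast
  moreover have "h \<in> extensional L" "f \<in> extensional L"
    using h ext f by (auto simp: limit_spectrum_def)
  ultimately have "h = f" by (intro extensionalityI[of _ L])
  with h show "f \<in> S" by simp
qed

section \<open>Extension of the joint spectrum\<close>

theorem theorem3p7:
  fixes \<sigma> :: "('a::complex_banach \<Rightarrow>\<^sub>L 'a) set \<Rightarrow> (('a \<Rightarrow>\<^sub>L 'a) \<Rightarrow> complex) set"
  assumes "joint_spectrum \<sigma>"
  shows "\<exists>!\<tau> :: ('a \<Rightarrow>\<^sub>L 'a) set \<Rightarrow> (('a \<Rightarrow>\<^sub>L 'a) \<Rightarrow> complex) set.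
    \<tau> \<in> extensional {L. quasi_solvable L} \<and>
    (\<forall>L. quasi_solvable L \<longrightarrow>
      (\<tau> L \<subseteq> characters L \<and> \<tau> L \<noteq> {} \<and>
       compactin
         (product_topology (\<lambda>I. subtopology (dual_topology I) (\<sigma> I)) (fs_ideals L))
         ((\<lambda>f. \<lambda>I\<in>fs_ideals L. restrict f I) ` \<tau> L)) \<and>
      (\<forall>H\<in>fs_ideals L. \<tau> H = \<sigma> H) \<and>
      (\<forall>M H. lie_subalgebra M L \<and> lie_ideal H M \<longrightarrow>
         (\<lambda>f. restrict f H) ` \<tau> M = \<tau> H))"
  (is "\<exists>!\<tau>. ?P \<tau>")
proof (rule ex1I)
  let ?\<tau> = "restrict (limit_spectrum \<sigma>) {L. quasi_solvable L}"
  have sub: "lie_subalgebra H M" if "lie_algebra M" "lie_ideal H M" for H M :: "('a \<Rightarrow>\<^sub>L 'a) set"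
    using that lie_ideal_imp_lie_algebra[OF that] by (simp add: lie_subalgebra_def lie_ideal_def)
  have \<tau>: "?\<tau> M = limit_spectrum \<sigma> M" if "quasi_solvable L" "lie_subalgebra M L" for L M
    using quasi_solvable_subalgebra[OF that] by simp
  have "?\<tau> H = \<sigma> H" if L: "quasi_solvable L" and H: "H \<in> fs_ideals L" for L H
  proof -
    note D = fs_idealsD[OF H]
    have alg: "lie_algebra L" using L by (simp add: quasi_solvable_iff)
    show ?thesis
      using \<tau>[OF L sub[OF alg D(1)]]
        limit_spectrum_fin_dim[OF assms lie_ideal_imp_lie_algebra[OF alg D(1)] D(2,3)] by simp
  qed
  moreover have "(\<lambda>f. restrict f H) ` ?\<tau> M = ?\<tau> H"
    if L: "quasi_solvable L" and M: "lie_subalgebra M L" and H: "lie_ideal H M" for L M H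
  proof -
    have qM: "quasi_solvable M" by (rule quasi_solvable_subalgebra[OF L M])
    then have "lie_subalgebra H M" using sub[OF _ H] by (simp add: quasi_solvable_iff)
    then show ?thesis
      using \<tau>[OF L M] \<tau>[OF qM] limit_spectrum_projection[OF assms qM H] by simp
  qed
  ultimately show "?P ?\<tau>"
    using limit_spectrum_characters[OF assms] limit_spectrum_nonempty[OF assms]
      limit_spectrum_compact[OF assms] by simp
next
  fix \<tau> assume P: "?P \<tau>"
  show "\<tau> = restrict (limit_spectrum \<sigma>) {L. quasi_solvable L}"
  proof (rule extensionalityI[of _ "{L. quasi_solvable L}"])
    show "\<tau> \<in> extensional {L. quasi_solvable L}" using P by blast
  next
    fix L :: "('a \<Rightarrow>\<^sub>L 'a) set"
    assume "L \<in> {L. quasi_solvable L}"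
    then have L: "quasi_solvable L" by simp
    then have self: "lie_subalgebra L L" by (simp add: lie_subalgebra_def quasi_solvable_iff)
    have "\<tau> L = limit_spectrum \<sigma> L"
    proof (rule compact_eq_limit_spectrum[OF assms L])
      show "\<tau> L \<subseteq> extensional L" using P L by (auto simp: characters_def lie_dual_def)
      show "compactin (spectra_topology \<sigma> L) (ideal_restrictions L ` \<tau> L)" using P L by blast
      show "(\<lambda>f. restrict f I) ` \<tau> L = \<sigma> I" if I: "I \<in> fs_ideals L" for I
      proof -
        have "(\<lambda>f. restrict f I) ` \<tau> L = \<tau> I" using P L self fs_idealsD(1)[OF I] by blast
        also have "\<tau> I = \<sigma> I" using P L I by blast
        finally show ?thesis .
      qed
    qed
    then show "\<tau> L = restrict (limit_spectrum \<sigma>) {L. quasi_solvable L} L" using L by simp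
  qed simp
qed

end
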